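(* Let $\nu>0$ be a real number such that for every $\varepsilon>0$ there is a constant $C_\varepsilon$ with $$E_4(r,j,M,H)\leqslant C_\varepsilon H^{2-\nu}M^2\left(\frac{H^3M^2}{r}+HM\right)r^{\varepsilon}$$ whenever $r,j\in\mathbb{N}$, $\gcd(r,j)=1$ and $1\leqslant H\leqslant M\leqslant r$. Let $r,j\in\mathbb{N}$ with $\gcd(r,j)=1$ and $1\leqslant L,M\leqslant r$; let $f:[1,M]\to\mathbb{R}$ be continuously differentiable with $|f'(x)|\leqslant F$ on $[1,M]$, where $F\leqslant L^{-1}$; let $\boldsymbol{\alpha}=(\alpha_l)_{|l|\leqslant L}$, $\boldsymbol{\beta}=(\beta_m)_{1\leqslant m\leqslant M}$ be any finite sequences of complex numbers; and let $H\in\mathbb{N}$ with $1\leqslant H\leqslant\min\{1/(LF),M\}$. Then for every $\varepsilon>0$, $$\Sigma(r,j,L,M,\boldsymbol{\alpha},\boldsymbol{\beta},f)\ll\left(H^{-1/2}L^{1/2}M+H^{1/8-\nu/8}L^{3/8}M+H^{-1/8-\nu/8}L^{3/8}M^{7/8}r^{1/8}\right)\|\boldsymbol{\alpha}\|_2\|\boldsymbol{\beta}\|_\infty r^{\varepsilon},$$ where the implied constant depends only on $\varepsilon$ and $\nu$ (and the constants $C_\varepsilon$).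
   Context: For real $x$ and $r\in\mathbb{N}$, $e(x)=e^{2\pi i x}$, $e_r(x)=e(x/r)$. A modular square root of $s$ modulo $r$ is a residue $k$ modulo $r$ with $k^2\equiv s\pmod r$. $E_4(r,j,M,H)$ is the number of tuples $(m_1,\dots,m_8,k_1,\dots,k_8)$ with integers $1\leqslant m_i\leqslant M$, residues $k_i$ modulo $r$ with $k_i^2\equiv jm_i\pmod r$, $1\leqslant|m_i-m_{i+1}|\leqslant H$ for $i=1,3,5,7$, and $k_1-k_2+k_3-k_4\equiv k_5-k_6+k_7-k_8\pmod r$. Define $$\Sigma(r,j,L,M,\boldsymbol{\alpha},\boldsymbol{\beta},f):=\sum_{|l|\leqslant L}\sum_{1\leqslant m\leqslant M}\alpha_l\beta_m\sum_{\substack{k \bmod r\\ k^2\equiv jm \bmod r}} e_r(lk)\,e(lf(m)),$$ with $l,m$ integers. $\|\boldsymbol{\alpha}\|_2=(\sum_{|l|\leqslant L}|\alpha_l|^2)^{1/2}$, $\|\boldsymbol{\beta}\|_\infty=\max_{1\leqslant m\leqslant M}|\beta_m|$. If $F=0$, $1/(LF)$ is interpreted as $+\infty$. *)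

theory Defs
  imports Complex_Main "HOL-Library.FuncSet" "HOL-Number_Theory.Cong"
begin

definition e_unit :: "real \<Rightarrow> complex" where
  "e_unit x = exp (2 * complex_of_real pi * \<i> * complex_of_real x)"

definition e_mod :: "nat \<Rightarrow> int \<Rightarrow> complex" where
  "e_mod r n = e_unit (real_of_int n / real r)"

text \<open>Residues modulo \<open>r\<close> are represented by the integers \<open>0, \<dots>, r - 1\<close>.\<close>

definition mod_sqrts :: "nat \<Rightarrow> int \<Rightarrow> int set" where
  "mod_sqrts r s = {k. 0 \<le> k \<and> k < int r \<and> [k\<^sup>2 = s] (mod int r)}"

text \<open>The ranges of summation; the real parameters \<open>L\<close> and \<open>M\<close> need not be integers.\<close>

definition l_range :: "real \<Rightarrow> int set" where
  "l_range L = {l. real_of_int \<bar>l\<bar> \<le> L}"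

definition m_range :: "real \<Rightarrow> int set" where
  "m_range M = {m. 1 \<le> m \<and> real_of_int m \<le> M}"

text \<open>The tuples \<open>(m\<^sub>1, \<dots>, m\<^sub>8)\<close> and \<open>(k\<^sub>1, \<dots>, k\<^sub>8)\<close> are extensional functions on \<open>{1..8}\<close>,
  so that each tuple is counted exactly once.\<close>

definition E4 :: "nat \<Rightarrow> nat \<Rightarrow> real \<Rightarrow> nat \<Rightarrow> nat" where
  "E4 r j M H = card {(m, k).
     m \<in> {1..8::nat} \<rightarrow>\<^sub>E m_range M \<and>
     k \<in> (\<Pi>\<^sub>E i\<in>{1..8::nat}. mod_sqrts r (int j * m i)) \<and>
     (\<forall>i\<in>{1, 3, 5, 7}. 1 \<le> \<bar>m i - m (i + 1)\<bar> \<and> \<bar>m i - m (i + 1)\<bar> \<le> int H) \<and>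
     [k 1 - k 2 + k 3 - k 4 = k 5 - k 6 + k 7 - k 8] (mod int r)}"

definition Sigma_sum ::
  "nat \<Rightarrow> nat \<Rightarrow> real \<Rightarrow> real \<Rightarrow> (int \<Rightarrow> complex) \<Rightarrow> (int \<Rightarrow> complex) \<Rightarrow> (real \<Rightarrow> real) \<Rightarrow> complex" where
  "Sigma_sum r j L M \<alpha> \<beta> f =
     (\<Sum>l\<in>l_range L. \<Sum>m\<in>m_range M. \<alpha> l * \<beta> m *
        (\<Sum>k\<in>mod_sqrts r (int j * m). e_mod r (l * k) * e_unit (real_of_int l * f (real_of_int m))))"

definition norm2 :: "real \<Rightarrow> (int \<Rightarrow> complex) \<Rightarrow> real" where
  "norm2 L \<alpha> = sqrt (\<Sum>l\<in>l_range L. (cmod (\<alpha> l))\<^sup>2)"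

definition norm_inf :: "real \<Rightarrow> (int \<Rightarrow> complex) \<Rightarrow> real" where
  "norm_inf M \<beta> = Max ((\<lambda>m. cmod (\<beta> m)) ` m_range M)"

end

theory Submission
  imports Defs "HOL-Analysis.Analysis"
begin

text \<open>Cauchy-Schwarz over \<open>l\<close> removes \<open>\<alpha>\<close>. The range of \<open>m\<close> is cut into about \<open>M / H\<close> blocks of
  length \<open>H\<close>, and Cauchy-Schwarz over the blocks leaves only pairs \<open>m, m'\<close> in a common block.
  The diagonal \<open>m = m'\<close> costs \<open>L\<close> times the second moment of the number of modular square roots,
  which is at most \<open>4 * M\<close> times the square of the number of divisors of \<open>r\<close>. Off the diagonal,
  \<open>\<bar>f m - f m'\<bar> \<le> F * H \<le> 1 / L\<close>, so the twist by \<open>f\<close> can be expanded in a rapidly convergent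
  Taylor series; Hoelder's inequality over \<open>l\<close> and orthogonality of additive characters then bound
  each term by \<open>L powr (3 / 4) * (r * E4) powr (1 / 4)\<close>.\<close>

subsection \<open>Divisors and modular square roots\<close>

text \<open>A divisor is determined by its multiplicities at the primes dividing \<open>n\<close>,
  and each of them is at most the multiplicity in \<open>n\<close>; this embeds the divisors in a
  finite box.\<close>

lemma card_divisors_le_prod:
  fixes n :: nat
  assumes "n > 0"
  shows "card {d. d dvd n} \<le> (\<Prod>p\<in>prime_factors n. multiplicity p n + 1)"
proof -
  let ?v = "\<lambda>d. \<lambda>p\<in>prime_factors n. multiplicity p d"
  let ?P = "\<Pi>\<^sub>E p\<in>prime_factors n. {..multiplicity p n}"
  have "inj_on ?v {d. d dvd n}"
  proof (rule inj_onI)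
    fix d d' assume d: "d \<in> {d. d dvd n}" "d' \<in> {d. d dvd n}" and eq: "?v d = ?v d'"
    show "d = d'"
    proof (rule multiplicity_eq_nat)
      show "d > 0" "d' > 0" using d assms by (auto intro: Nat.gr0I)
      fix p :: nat assume p: "prime p"
      show "multiplicity p d = multiplicity p d'"
      proof (cases "p dvd n")
        case True
        then have "p \<in> prime_factors n" using p assms by (auto simp: prime_factors_dvd)
        with fun_cong[OF eq, of p] show ?thesis by simp
      next
        case False
        then have "\<not> p dvd d" "\<not> p dvd d'" using d dvd_trans by auto
        then show ?thesis by (simp add: not_dvd_imp_multiplicity_0)
      qed
    qed
  qed
  moreover have "?v ` {d. d dvd n} \<subseteq> ?P"
    using assms by (auto simp: dvd_imp_multiplicity_le)
  moreover have "finite ?P" by (intro finite_PiE) auto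
  ultimately have "card {d. d dvd n} \<le> card ?P" by (rule card_inj_on_le)
  also have "\<dots> = (\<Prod>p\<in>prime_factors n. multiplicity p n + 1)"
    by (simp add: card_PiE)
  finally show ?thesis .
qed

text \<open>Compare prime by prime: the quotient \<open>(a + 1) / p powr (a * \<epsilon>)\<close> is
  at most 1 for large \<open>p\<close> and at most a constant \<open>K\<close> for every
  \<open>p\<close>. Only primes up to a threshold \<open>B\<close> that depends on
  \<open>\<epsilon>\<close> alone contribute a factor \<open>K\<close>.\<close>

lemma divisor_bound:
  fixes \<epsilon> :: real
  assumes "\<epsilon> > 0"
  shows "\<exists>K>0. \<forall>n::nat>0. real (card {d. d dvd n}) \<le> K * real n powr \<epsilon>"
proof -
  \<comment> \<open>The worst prime is 2; convergence of these quotients gives a bound uniform in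
    the exponent \<open>a\<close>.\<close>
  have "(\<lambda>a. real (Suc a) * (1 / 2 powr \<epsilon>) ^ a) \<longlonglongrightarrow> 0"
  proof -
    have c: "norm (1 / 2 powr \<epsilon> :: real) < 1" using assms by simp
    have "(\<lambda>a. real a * (1 / 2 powr \<epsilon>) ^ a + (1 / 2 powr \<epsilon>) ^ a) \<longlonglongrightarrow> 0 + 0"
      by (intro tendsto_add powser_times_n_limit_0 LIMSEQ_power_zero c)
    then show ?thesis by (simp add: algebra_simps)
  qed
  then have "Bseq (\<lambda>a. real (Suc a) * (1 / 2 powr \<epsilon>) ^ a)"
    by (intro convergent_imp_Bseq convergentI)
  then obtain K0 where K0: "\<And>a. norm (real (Suc a) * (1 / 2 powr \<epsilon>) ^ a) \<le> K0"
    by (auto simp: Bseq_def)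
  \<comment> \<open>The maximum with 1 makes the powers of \<open>K\<close> increasing, so the at
    most \<open>B + 1\<close> primes up to \<open>B\<close> cost at most
    \<open>K ^ (B + 1)\<close>.\<close>
  define K where "K = max 1 K0"
  \<comment> \<open>Beyond this threshold \<open>p powr \<epsilon>\<close> is at least 2, and
    \<open>a + 1 \<le> 2 ^ a\<close> needs no constant.\<close>
  define B where "B = nat \<lceil>2 powr (1 / \<epsilon>)\<rceil>"
  have small: "real (a + 1) \<le> K * (real p powr \<epsilon>) ^ a" if "p \<ge> 2" for a p :: nat
  proof -
    have "real (Suc a) * (1 / 2 powr \<epsilon>) ^ a \<le> K"
      using K0[of a] unfolding K_def real_norm_def by linarith
    then have "real (Suc a) / (2 powr \<epsilon>) ^ a \<le> K"
      by (simp only: power_one_over) (simp add: divide_inverse)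
    then have "real (Suc a) \<le> K * (2 powr \<epsilon>) ^ a" by (simp add: field_simps)
    also have "\<dots> \<le> K * (real p powr \<epsilon>) ^ a"
      using that assms by (intro mult_left_mono power_mono powr_mono2) (auto simp: K_def)
    finally show ?thesis by simp
  qed
  have large: "real (a + 1) \<le> (real p powr \<epsilon>) ^ a" if "p > B" for a p :: nat
  proof -
    have "2 powr (1 / \<epsilon>) \<le> real p" using that unfolding B_def by linarith
    then have "(2 powr (1 / \<epsilon>)) powr \<epsilon> \<le> real p powr \<epsilon>"
      using assms by (intro powr_mono2) auto
    then have 2: "2 \<le> real p powr \<epsilon>" using assms by (simp add: powr_powr)
    have "real (a + 1) \<le> 2 ^ a" by (induction a) auto
    also have "\<dots> \<le> (real p powr \<epsilon>) ^ a" using 2 by (intro power_mono) auto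
    finally show ?thesis .
  qed
  have "real (card {d. d dvd n}) \<le> K ^ (B + 1) * real n powr \<epsilon>" if n: "n > 0" for n :: nat
  proof -
    let ?k = "\<lambda>p. if p \<le> B then K else 1"
    have "real (card {d. d dvd n}) \<le> real (\<Prod>p\<in>prime_factors n. multiplicity p n + 1)"
      using card_divisors_le_prod[OF n] by (simp only: of_nat_le_iff)
    also have "\<dots> = (\<Prod>p\<in>prime_factors n. real (multiplicity p n + 1))" by simp
    also have "\<dots> \<le> (\<Prod>p\<in>prime_factors n. ?k p * (real p powr \<epsilon>) ^ multiplicity p n)"
      using small large by (intro prod_mono)
        (auto simp: not_le simp del: of_nat_add of_nat_Suc dest!: in_prime_factors_imp_prime prime_ge_2_nat)
    also have "\<dots> = (\<Prod>p\<in>prime_factors n. ?k p) * (\<Prod>p\<in>prime_factors n. real p ^ multiplicity p n) powr \<epsilon>"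
    proof -
      have "(real p powr \<epsilon>) ^ a = (real p ^ a) powr \<epsilon>" if "p \<in> prime_factors n" for p a
      proof -
        have "real p > 0" using in_prime_factors_imp_prime[OF that] prime_gt_0_nat by simp
        then show ?thesis by (simp add: powr_powr powr_power mult.commute flip: powr_realpow)
      qed
      then show ?thesis by (simp add: prod.distrib prod_powr_distrib)
    qed
    also have "(\<Prod>p\<in>prime_factors n. real p ^ multiplicity p n) = real n"
      using prod_prime_factors[of n] n by (simp flip: of_nat_power of_nat_prod)
    also have "(\<Prod>p\<in>prime_factors n. ?k p) \<le> K ^ (B + 1)"
    proof -
      have "(\<Prod>p\<in>prime_factors n. ?k p) = (\<Prod>p\<in>prime_factors n \<inter> {..B}. K)"
        by (simp add: prod.If_cases Int_def)
      also have "\<dots> \<le> K ^ (B + 1)"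
        using card_mono[of "{..B}" "prime_factors n \<inter> {..B}"]
        by (simp del: power_Suc) (intro power_increasing, auto simp: K_def)
      finally show ?thesis .
    qed
    finally show ?thesis by (simp add: mult_right_mono)
  qed
  moreover have "K ^ (B + 1) > 0" by (simp add: K_def)
  ultimately show ?thesis by blast
qed

section \<open>Mean square of the number of modular square roots\<close>

lemma finite_mod_sqrts [simp]: "finite (mod_sqrts r s)"
  by (rule finite_subset[of _ "{0..<int r}"]) (auto simp: mod_sqrts_def)

lemma finite_l_range [simp]: "finite (l_range L)"
  by (rule finite_subset[of _ "{-\<lfloor>L\<rfloor>..\<lfloor>L\<rfloor>}"]) (auto simp: l_range_def; linarith)+

lemma finite_m_range [simp]: "finite (m_range M)"
  by (rule finite_subset[of _ "{1..\<lfloor>M\<rfloor>}"]) (auto simp: m_range_def le_floor_iff)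

text \<open>The quotient \<open>4 * m div D\<close> is an integer between 1 and
  \<open>4 * M / D\<close> and determines \<open>m\<close>. Since it is at least 1, no additive
  error occurs, even when \<open>D\<close> exceeds \<open>4 * M\<close>.\<close>

lemma card_m_range_dvd_le:
  fixes D :: nat
  assumes "D > 0" "M \<ge> 0"
  shows "real (card {m\<in>m_range M. int D dvd 4 * m}) * real D \<le> 4 * M"
proof -
  let ?S = "{m\<in>m_range M. int D dvd 4 * m}"
  have "card ?S \<le> card {1..\<lfloor>4 * M / real D\<rfloor>}"
  proof (rule card_inj_on_le)
    show "inj_on (\<lambda>m. 4 * m div int D) ?S"
      using assms by (auto intro!: inj_onI simp: dvd_div_eq_iff)
    show "(\<lambda>m. 4 * m div int D) ` ?S \<subseteq> {1..\<lfloor>4 * M / real D\<rfloor>}"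
    proof safe
      fix m assume m: "m \<in> m_range M" "int D dvd 4 * m"
      then obtain q where q: "4 * m = int D * q" by auto
      have "m \<ge> 1" "real_of_int m \<le> M" using m by (auto simp: m_range_def)
      have "int D * q > 0" using \<open>m \<ge> 1\<close> q by linarith
      then have "q \<ge> 1" using assms by (simp add: zero_less_mult_iff)
      moreover have "real_of_int q * real D \<le> 4 * M"
        using arg_cong[OF q, of real_of_int] \<open>real_of_int m \<le> M\<close> by (simp add: mult.commute)
      then have "q \<le> \<lfloor>4 * M / real D\<rfloor>" using assms by (simp add: le_floor_iff field_simps)
      ultimately show "4 * m div int D \<in> {1..\<lfloor>4 * M / real D\<rfloor>}" using q assms by simp
    qed
  qed simp
  then have "real (card ?S) \<le> real_of_int \<lfloor>4 * M / real D\<rfloor>"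
    using assms by (simp add: le_nat_iff)
  also have "\<dots> \<le> 4 * M / real D" by linarith
  finally show ?thesis using assms by (simp add: field_simps)
qed

text \<open>Elements of one residue class modulo \<open>q\<close> are separated by their quotients
  by \<open>q\<close>, which take at most \<open>g\<close> values. For \<open>q = 0\<close> the set
  is empty.\<close>

lemma card_congruent_le:
  fixes S :: "int set" and g q :: nat
  assumes S: "S \<subseteq> {0..<int (g * q)}" and cong: "\<And>k k'. k \<in> S \<Longrightarrow> k' \<in> S \<Longrightarrow> int q dvd k - k'"
  shows "card S \<le> g"
proof (cases "q = 0")
  case False
  have "card S \<le> card {0..<int g}"
  proof (rule card_inj_on_le)
    show "inj_on (\<lambda>k. k div int q) S"
    proof (rule inj_onI)
      fix k k' assume k: "k \<in> S" "k' \<in> S" "k div int q = k' div int q"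
      then have "k mod int q = k' mod int q" using cong by (simp add: mod_eq_dvd_iff)
      with k show "k = k'" by (metis div_mult_mod_eq)
    qed
    show "(\<lambda>k. k div int q) ` S \<subseteq> {0..<int g}"
    proof safe
      fix k assume "k \<in> S"
      then have "0 \<le> k" "k < int g * int q" using S by auto
      have "k div int q * int q \<le> k" using div_mult_mod_eq[of k "int q"] pos_mod_sign[of "int q" k] False by linarith
      with \<open>k < int g * int q\<close> have "k div int q * int q < int g * int q" by linarith
      then have "k div int q < int g" by (simp add: mult_less_cancel_right)
      then show "k div int q \<in> {0..<int g}" using \<open>0 \<le> k\<close> False by (simp add: pos_imp_zdiv_nonneg_iff)
    qed
  qed simp
  then show ?thesis by simp
qed (use S in auto)

text \<open>Two square roots \<open>k, k'\<close> satisfy \<open>r dvd (k - k') * (k + k')\<close>, so a divisor \<open>d\<close> of \<open>r\<close> divides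
  \<open>k - k'\<close> and \<open>r div d\<close> divides \<open>k + k'\<close>. Given \<open>d\<close>, this fixes \<open>k\<close> modulo
  \<open>lcm d (r div d) = r div g\<close> with \<open>g = gcd d (r div d)\<close>, and is solvable only if \<open>g dvd 2 * k'\<close>.\<close>
lemma card_mod_sqrts_le:
  fixes r j :: nat and m :: int
  assumes r: "r > 0" and cop: "coprime r j"
  defines "g \<equiv> \<lambda>d. gcd d (r div d)"
  shows "card (mod_sqrts r (int j * m)) \<le>
    (\<Sum>d | d dvd r. if int ((g d)\<^sup>2) dvd 4 * m then g d else 0)"
proof (cases "mod_sqrts r (int j * m) = {}")
  case False
  then obtain k0 where k0: "k0 \<in> mod_sqrts r (int j * m)" by auto
  define U where "U = (\<lambda>d. {k\<in>{0..<int r}. int d dvd k - k0 \<and> int (r div d) dvd k + k0})"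
  have finU: "finite (U d)" for d
    by (rule finite_subset[of _ "{0..<int r}"]) (auto simp: U_def)
  have "mod_sqrts r (int j * m) \<subseteq> (\<Union>d\<in>{d. d dvd r}. U d)"
  proof
    fix k assume k: "k \<in> mod_sqrts r (int j * m)"
    have "[k\<^sup>2 = k0\<^sup>2] (mod int r)"
      using k k0 unfolding mod_sqrts_def by (auto intro: cong_trans cong_sym)
    then have "int r dvd (k - k0) * (k + k0)"
      by (simp add: cong_iff_dvd_diff power2_eq_square algebra_simps)
    \<comment> \<open>With this gcd, \<open>(k - k0) div d\<close> is coprime to
      \<open>r div d\<close>, so the divisibility of the product by \<open>r\<close> forces
      \<open>r div d\<close> to divide \<open>k + k0\<close>.\<close>
    define d where "d = nat (gcd (k - k0) (int r))"
    have d: "int d = gcd (k - k0) (int r)" by (simp add: d_def)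
    then have "int d dvd int r" "int d dvd k - k0" by simp_all
    then have dr: "d dvd r" by (simp add: int_dvd_int_iff)
    then have "d > 0" using r by (auto intro: Nat.gr0I)
    have "int (r div d) dvd k + k0"
    proof -
      have "coprime ((k - k0) div int d) (int r div int d)"
        unfolding d using r by (intro div_gcd_coprime) auto
      moreover have "int r div int d dvd (k - k0) div int d * (k + k0)"
      proof -
        have "int d * (int r div int d) dvd int d * ((k - k0) div int d * (k + k0))"
          using \<open>int r dvd (k - k0) * (k + k0)\<close> \<open>int d dvd int r\<close> \<open>int d dvd k - k0\<close>
          by (simp add: mult.assoc[symmetric])
        then show ?thesis using \<open>d > 0\<close> by simp
      qed
      ultimately show ?thesis
        by (simp add: zdiv_int coprime_commute coprime_dvd_mult_right_iff)
    qed
    then have "k \<in> U d" using k \<open>int d dvd k - k0\<close> by (auto simp: U_def mod_sqrts_def)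
    then show "k \<in> (\<Union>d\<in>{d. d dvd r}. U d)" using dr by auto
  qed
  then have "card (mod_sqrts r (int j * m)) \<le> card (\<Union>d\<in>{d. d dvd r}. U d)"
    using r by (intro card_mono finite_UN_I finU) auto
  also have "\<dots> \<le> (\<Sum>d | d dvd r. card (U d))"
    using r by (intro card_UN_le) auto
  also have "\<dots> \<le> (\<Sum>d | d dvd r. if int ((g d)\<^sup>2) dvd 4 * m then g d else 0)"
  proof (rule sum_mono, clarify)
    fix d assume dr: "d dvd r"
    then have "d > 0" using r by (auto intro: Nat.gr0I)
    have r_eq: "d * (r div d) = r" using dr by simp
    have r_lcm: "r = g d * lcm d (r div d)"
      unfolding g_def prod_gcd_lcm_nat[symmetric] r_eq ..
    have "(g d)\<^sup>2 dvd d * (r div d)"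
      by (auto simp: g_def power2_eq_square intro: mult_dvd_mono)
    then have g2: "(g d)\<^sup>2 dvd r" unfolding r_eq .
    show "card (U d) \<le> (if int ((g d)\<^sup>2) dvd 4 * m then g d else 0)"
    proof (cases "U d = {}")
      case False
      then obtain k where k: "int d dvd k - k0" "int (r div d) dvd k + k0" by (auto simp: U_def)
      \<comment> \<open>\<open>g d\<close> divides the difference \<open>2 * k0\<close>, so its
        square divides \<open>4 * k0\<^sup>2\<close>. That square also divides \<open>r\<close>,
        hence \<open>4 * k0\<^sup>2\<close> may be replaced by \<open>4 * j * m\<close>, and
        \<open>j\<close> is cancelled by coprimality.\<close>
      have "int (g d) dvd k - k0" "int (g d) dvd k + k0"
        using k unfolding g_def by (meson dvd_trans gcd_dvd1 gcd_dvd2 int_dvd_int_iff)+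
      from dvd_diff[OF this(2) this(1)] have "int (g d) dvd 2 * k0" by simp
      then have "(int (g d))\<^sup>2 dvd (2 * k0)\<^sup>2" by (rule dvd_power_same)
      then have *: "int ((g d)\<^sup>2) dvd 4 * k0\<^sup>2" by (simp add: power_mult_distrib)
      have "[k0\<^sup>2 = int j * m] (mod int ((g d)\<^sup>2))"
        using k0 g2 unfolding mod_sqrts_def
        by (auto intro: cong_dvd_modulus simp: int_dvd_int_iff simp del: of_nat_power)
      then have "[4 * k0\<^sup>2 = 4 * (int j * m)] (mod int ((g d)\<^sup>2))" by (rule cong_scalar_left)
      with * have "int ((g d)\<^sup>2) dvd 4 * (int j * m)" by (simp add: cong_dvd_iff)
      then have "int ((g d)\<^sup>2) dvd int j * (4 * m)" by (simp add: mult_ac)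
      moreover have "coprime (int ((g d)\<^sup>2)) (int j)"
        using coprime_divisors[OF g2 dvd_refl cop] by (simp only: coprime_int_iff)
      ultimately have "int ((g d)\<^sup>2) dvd 4 * m" by (simp add: coprime_dvd_mult_right_iff)
      moreover have "card (U d) \<le> g d"
      proof (rule card_congruent_le)
        show "U d \<subseteq> {0..<int (g d * lcm d (r div d))}"
          using r_lcm by (auto simp: U_def)
        fix k k' assume "k \<in> U d" "k' \<in> U d"
        then have "int d dvd (k - k0) - (k' - k0)" "int (r div d) dvd (k + k0) - (k' + k0)"
          unfolding U_def by (blast intro: dvd_diff)+
        then show "int (lcm d (r div d)) dvd k - k'" by (simp flip: lcm_int_int_eq)
      qed
      ultimately show ?thesis by simp
    qed simp
  qed
  finally show ?thesis .
qed simp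

text \<open>Cauchy-Schwarz over the divisors \<open>d\<close> costs one factor
  \<open>card {d. d dvd r}\<close>. After exchanging the sums, the weight
  \<open>(g d)\<^sup>2\<close> is balanced by the sparsity of the \<open>m\<close> with
  \<open>(g d)\<^sup>2\<close> dividing \<open>4 * m\<close>, so each \<open>d\<close> contributes
  at most \<open>4 * M\<close>.\<close>

lemma sum_card_mod_sqrts_le:
  fixes r j :: nat
  assumes r: "r > 0" and cop: "coprime r j" and M: "M \<ge> 0"
  shows "(\<Sum>m\<in>m_range M. (real (card (mod_sqrts r (int j * m))))\<^sup>2)
    \<le> 4 * M * (real (card {d. d dvd r}))\<^sup>2"
proof -
  define g where "g = (\<lambda>d. gcd d (r div d))"
  define a where "a = (\<lambda>m d. if int ((g d)\<^sup>2) dvd 4 * m then real (g d) else 0)"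
  let ?D = "{d. d dvd r}"
  have "(\<Sum>m\<in>m_range M. (real (card (mod_sqrts r (int j * m))))\<^sup>2) \<le>
    (\<Sum>m\<in>m_range M. (\<Sum>d\<in>?D. (a m d)\<^sup>2) * real (card ?D))"
  proof (rule sum_mono)
    fix m
    have "real (card (mod_sqrts r (int j * m))) \<le>
        real (\<Sum>d | d dvd r. if int ((g d)\<^sup>2) dvd 4 * m then g d else 0)"
      using card_mod_sqrts_le[OF r cop, of m] unfolding g_def by (simp only: of_nat_le_iff)
    also have "\<dots> = (\<Sum>d\<in>?D. a m d)"
      by (auto simp: a_def intro!: sum.cong)
    finally have "(real (card (mod_sqrts r (int j * m))))\<^sup>2 \<le> (\<Sum>d\<in>?D. a m d)\<^sup>2"
      by (rule power_mono) simp
    also have "\<dots> \<le> (\<Sum>d\<in>?D. (a m d)\<^sup>2) * real (card ?D)"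
      by (rule sum_squared_le_sum_of_squares)
    finally show "(real (card (mod_sqrts r (int j * m))))\<^sup>2 \<le> (\<Sum>d\<in>?D. (a m d)\<^sup>2) * real (card ?D)" .
  qed
  also have "\<dots> = (\<Sum>d\<in>?D. \<Sum>m\<in>m_range M. (a m d)\<^sup>2) * real (card ?D)"
    by (subst sum.swap) (simp add: sum_distrib_right)
  also have "\<dots> \<le> (\<Sum>d\<in>?D. 4 * M) * real (card ?D)"
  proof (intro mult_right_mono sum_mono)
    fix d assume "d \<in> ?D"
    then have "d > 0" using r by (auto intro: Nat.gr0I)
    then have "g d > 0" by (simp add: g_def)
    have "(\<Sum>m\<in>m_range M. (a m d)\<^sup>2) = (\<Sum>m\<in>{m\<in>m_range M. int ((g d)\<^sup>2) dvd 4 * m}. real ((g d)\<^sup>2))"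
      unfolding sum.inter_filter[OF finite_m_range] by (rule sum.cong) (auto simp: a_def)
    also have "\<dots> \<le> 4 * M"
      using card_m_range_dvd_le[of "(g d)\<^sup>2" M] \<open>g d > 0\<close> M by simp
    finally show "(\<Sum>m\<in>m_range M. (a m d)\<^sup>2) \<le> 4 * M" .
  qed simp
  also have "\<dots> = 4 * M * (real (card ?D))\<^sup>2" by (simp add: power2_eq_square)
  finally show ?thesis .
qed

subsection \<open>Moments of exponential sums\<close>

lemma norm_e_unit [simp]: "cmod (e_unit x) = 1"
  by (simp add: e_unit_def)

lemma e_unit_add: "e_unit (x + y) = e_unit x * e_unit y"
  by (simp add: e_unit_def algebra_simps exp_add)

lemma e_unit_minus: "e_unit (- x) = cnj (e_unit x)"
  by (simp add: e_unit_def exp_cnj)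

lemma e_unit_of_int [simp]: "e_unit (of_int n) = 1"
  unfolding e_unit_def exp_eq_1 by (auto intro!: exI[of _ n])

lemma norm_e_mod [simp]: "cmod (e_mod r n) = 1"
  by (simp add: e_mod_def)

lemma e_mod_add: "e_mod r (m + n) = e_mod r m * e_mod r n"
  by (simp add: e_mod_def add_divide_distrib e_unit_add)

lemma e_mod_minus: "e_mod r (- n) = cnj (e_mod r n)"
  by (simp add: e_mod_def e_unit_minus flip: minus_divide_left)

lemma e_mod_diff: "e_mod r (m - n) = e_mod r m * cnj (e_mod r n)"
  using e_mod_add[of r m "- n"] by (simp add: e_mod_minus)

lemma e_mod_mult_modulus: "r > 0 \<Longrightarrow> e_mod r (int r * n) = 1"
  by (simp add: e_mod_def)

lemma e_mod_periodic: "r > 0 \<Longrightarrow> e_mod r ((l + int r * q) * n) = e_mod r (l * n)"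
  using e_mod_mult_modulus[of r "q * n"] by (simp add: distrib_right e_mod_add mult.assoc)

lemma e_mod_mult_nat: "e_mod r (int l * n) = e_mod r n ^ l"
  by (induction l) (simp_all add: distrib_right e_mod_add, simp add: e_mod_def e_unit_def)

lemma e_mod_eq_1_iff:
  assumes "r > 0"
  shows "e_mod r n = 1 \<longleftrightarrow> int r dvd n"
proof
  assume "e_mod r n = 1"
  then obtain k :: int where "2 * pi * (real_of_int n / real r) = of_int (2 * k) * pi"
    by (auto simp: e_mod_def e_unit_def exp_eq_1)
  then have "real_of_int n = real_of_int (int r * k)"
    using assms by (simp add: field_simps)
  then have "n = int r * k" by (simp only: of_int_eq_iff)
  then show "int r dvd n" by simp
qed (use assms e_mod_mult_modulus in \<open>auto elim!: dvdE\<close>)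

text \<open>Orthogonality: unless \<open>r\<close> divides \<open>n\<close>, this is a geometric sum
  whose ratio is a nontrivial \<open>r\<close>-th root of unity.\<close>

lemma sum_e_mod:
  assumes "r > 0"
  shows "(\<Sum>l<r. e_mod r (int l * n)) = (if int r dvd n then of_nat r else 0)"
proof (cases "int r dvd n")
  case True
  then have "e_mod r n = 1" using e_mod_eq_1_iff assms by blast
  with True show ?thesis by (simp add: e_mod_mult_nat)
next
  case False
  then have "e_mod r n \<noteq> 1" using e_mod_eq_1_iff assms by blast
  moreover have "e_mod r n ^ r = 1"
    using e_mod_mult_modulus[OF assms, of n] by (simp add: e_mod_mult_nat)
  ultimately show ?thesis using False by (simp add: e_mod_mult_nat geometric_sum)
qed

section \<open>Second and fourth moments over complete and short ranges\<close>

text \<open>Expanding the square, orthogonality leaves only pairs with congruent frequencies. The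
  coefficients are arbitrary up to the bound \<open>B\<close>, so that factors depending on
  \<open>p\<close> can later be absorbed into them.\<close>

lemma second_moment_le:
  fixes a :: "'p \<Rightarrow> complex" and \<kappa> :: "'p \<Rightarrow> int"
  assumes fin: "finite P" and r: "r > 0" and a: "\<And>p. p \<in> P \<Longrightarrow> cmod (a p) \<le> B"
  shows "(\<Sum>l<r. (cmod (\<Sum>p\<in>P. a p * e_mod r (int l * \<kappa> p)))\<^sup>2)
    \<le> real r * B\<^sup>2 * real (card {(p, q). p \<in> P \<and> q \<in> P \<and> [\<kappa> p = \<kappa> q] (mod int r)})"
proof -
  let ?S = "\<lambda>l. \<Sum>p\<in>P. a p * e_mod r (int l * \<kappa> p)"
  let ?C = "{(p, q). p \<in> P \<and> q \<in> P \<and> [\<kappa> p = \<kappa> q] (mod int r)}"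
  have C: "?C = {x\<in>P \<times> P. int r dvd \<kappa> (fst x) - \<kappa> (snd x)}"
    by (auto simp: cong_iff_dvd_diff)
  have "complex_of_real (\<Sum>l<r. (cmod (?S l))\<^sup>2) = (\<Sum>l<r. ?S l * cnj (?S l))"
    by (simp add: complex_norm_square[symmetric] del: cnj_sum)
  also have "\<dots> = (\<Sum>l<r. \<Sum>x\<in>P \<times> P. a (fst x) * cnj (a (snd x)) * e_mod r (int l * (\<kappa> (fst x) - \<kappa> (snd x))))"
    by (simp add: sum_product sum.cartesian_product case_prod_beta e_mod_diff right_diff_distrib mult_ac)
  also have "\<dots> = (\<Sum>x\<in>P \<times> P. a (fst x) * cnj (a (snd x)) * (\<Sum>l<r. e_mod r (int l * (\<kappa> (fst x) - \<kappa> (snd x)))))"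
    by (subst sum.swap) (simp add: sum_distrib_left)
  also have "\<dots> = (\<Sum>x\<in>?C. a (fst x) * cnj (a (snd x)) * of_nat r)"
    unfolding C sum_e_mod[OF r] using fin by (subst sum.inter_filter) (auto intro!: sum.cong)
  finally have eq: "complex_of_real (\<Sum>l<r. (cmod (?S l))\<^sup>2) = (\<Sum>x\<in>?C. a (fst x) * cnj (a (snd x)) * of_nat r)" .
  \<comment> \<open>The moment is real and nonnegative, so it equals the modulus of the complex
    expression just computed, to which the triangle inequality applies.\<close>
  have "(\<Sum>l<r. (cmod (?S l))\<^sup>2) = cmod (complex_of_real (\<Sum>l<r. (cmod (?S l))\<^sup>2))"
    unfolding norm_of_real by (simp add: sum_nonneg)
  also have "\<dots> = cmod (\<Sum>x\<in>?C. a (fst x) * cnj (a (snd x)) * of_nat r)"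
    unfolding eq ..
  also have "\<dots> \<le> (\<Sum>x\<in>?C. B * B * real r)"
  proof (rule sum_norm_le)
    fix x assume "x \<in> ?C"
    then have x: "fst x \<in> P" "snd x \<in> P" by auto
    have "cmod (a (fst x)) * cmod (a (snd x)) \<le> B * B"
      using a[OF x(1)] a[OF x(2)] by (intro mult_mono) (auto intro: order_trans[OF norm_ge_zero])
    then show "cmod (a (fst x) * cnj (a (snd x)) * of_nat r) \<le> B * B * real r"
      by (simp add: norm_mult mult_right_mono)
  qed
  also have "\<dots> = real r * B\<^sup>2 * real (card ?C)"
    by (simp only: sum_constant power2_eq_square mult_ac)
  finally show ?thesis .
qed

text \<open>The square of the sum is again such a sum, indexed by \<open>P \<times> P\<close>, with
  frequencies \<open>\<kappa> p + \<kappa> q\<close> and coefficients bounded by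
  \<open>B\<^sup>2\<close>; its second moment is the fourth moment wanted.\<close>

lemma fourth_moment_le:
  fixes a :: "'p \<Rightarrow> complex" and \<kappa> :: "'p \<Rightarrow> int"
  assumes fin: "finite P" and r: "r > 0" and a: "\<And>p. p \<in> P \<Longrightarrow> cmod (a p) \<le> B"
  shows "(\<Sum>l<r. (cmod (\<Sum>p\<in>P. a p * e_mod r (int l * \<kappa> p))) ^ 4)
    \<le> real r * B ^ 4 * real (card {((p, q), (p', q')). p \<in> P \<and> q \<in> P \<and> p' \<in> P \<and> q' \<in> P \<and>
         [\<kappa> p + \<kappa> q = \<kappa> p' + \<kappa> q'] (mod int r)})" (is "_ \<le> _ * real (card ?N)")
proof -
  let ?a = "\<lambda>x. a (fst x) * a (snd x)" and ?k = "\<lambda>x. \<kappa> (fst x) + \<kappa> (snd x)"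
  have "(\<Sum>p\<in>P. a p * e_mod r (int l * \<kappa> p))\<^sup>2 = (\<Sum>x\<in>P \<times> P. ?a x * e_mod r (int l * ?k x))" for l
    unfolding power2_eq_square sum_product sum.cartesian_product case_prod_beta
    by (intro sum.cong refl) (simp add: e_mod_add distrib_left)
  from this[symmetric] have "(cmod (\<Sum>p\<in>P. a p * e_mod r (int l * \<kappa> p))) ^ 4 =
      (cmod (\<Sum>x\<in>P \<times> P. ?a x * e_mod r (int l * ?k x)))\<^sup>2" for l
    by (simp only: norm_power flip: power_mult) simp
  then have "(\<Sum>l<r. (cmod (\<Sum>p\<in>P. a p * e_mod r (int l * \<kappa> p))) ^ 4) =
      (\<Sum>l<r. (cmod (\<Sum>x\<in>P \<times> P. ?a x * e_mod r (int l * ?k x)))\<^sup>2)" by simp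
  also have "\<dots> \<le> real r * (B\<^sup>2)\<^sup>2 *
      real (card {(x, y). x \<in> P \<times> P \<and> y \<in> P \<times> P \<and> [?k x = ?k y] (mod int r)})"
  proof (rule second_moment_le[OF _ r])
    fix x assume "x \<in> P \<times> P"
    then have x: "fst x \<in> P" "snd x \<in> P" by auto
    show "cmod (?a x) \<le> B\<^sup>2"
      unfolding norm_mult power2_eq_square
      using a[OF x(1)] a[OF x(2)] by (intro mult_mono) (auto intro: order_trans[OF norm_ge_zero])
  qed (use fin in simp)
  also have "{(x, y). x \<in> P \<times> P \<and> y \<in> P \<times> P \<and> [?k x = ?k y] (mod int r)} = ?N" by auto
  finally show ?thesis by (simp only: power_mult[symmetric]) simp
qed

lemma sum_l_range_periodic_le:
  fixes g :: "int \<Rightarrow> real"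
  assumes per: "\<And>l q. g (l + int r * q) = g l" and g: "\<And>l. g l \<ge> 0" and L: "L \<le> real r"
    and r: "r > 0"
  shows "(\<Sum>l\<in>l_range L. g l) \<le> 3 * (\<Sum>l<r. g (int l))"
proof -
  \<comment> \<open>Three periods cover the range; the quotient 1 is reached only by
    \<open>l = r\<close>.\<close>
  have "l_range L \<subseteq> (\<lambda>(q, l). int l + int r * q) ` ({-1, 0, 1} \<times> {..<r})"
  proof
    fix l assume "l \<in> l_range L"
    then have l: "- int r \<le> l" "l \<le> int r" using L by (auto simp: l_range_def)
    have "int (nat (l mod int r)) + int r * (l div int r) = l" using r by simp
    moreover have "l div int r \<in> {-1, 0, 1}"
    proof -
      have "- 1 \<le> l div int r" using zdiv_mono1[OF l(1), of "int r"] r by (simp add: zdiv_zminus1_eq_if)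
      moreover have "l div int r \<le> 1" using zdiv_mono1[OF l(2), of "int r"] r by simp
      ultimately show ?thesis by auto
    qed
    moreover have "nat (l mod int r) < r" using r by (simp add: nat_less_iff)
    ultimately show "l \<in> (\<lambda>(q, l). int l + int r * q) ` ({-1, 0, 1} \<times> {..<r})"
      by (intro image_eqI[of _ _ "(l div int r, nat (l mod int r))"]) auto
  qed
  then have "(\<Sum>l\<in>l_range L. g l) \<le> (\<Sum>l\<in>(\<lambda>(q, l). int l + int r * q) ` ({-1, 0, 1} \<times> {..<r}). g l)"
    using g by (intro sum_mono2) auto
  also have "\<dots> \<le> (\<Sum>x\<in>{-1, 0, 1} \<times> {..<r}. (g \<circ> (\<lambda>(q, l). int l + int r * q)) x)"
    by (rule sum_image_le) (use g in auto)
  also have "\<dots> = (\<Sum>q\<in>{-1, 0, 1}. \<Sum>l<r. g (int l + int r * q))"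
    unfolding sum.cartesian_product by (simp only: case_prod_unfold comp_def)
  also have "\<dots> = 3 * (\<Sum>l<r. g (int l))"
    by (simp only: per) simp
  finally show ?thesis .
qed

text \<open>Hoelder's inequality with exponents 4 and 4/3, obtained from two applications of
  Cauchy-Schwarz.\<close>

lemma power4_sum_le:
  fixes g :: "'i \<Rightarrow> real"
  shows "(\<Sum>i\<in>I. g i) ^ 4 \<le> real (card I) ^ 3 * (\<Sum>i\<in>I. g i ^ 4)"
proof -
  have "((\<Sum>i\<in>I. g i)\<^sup>2)\<^sup>2 \<le> ((\<Sum>i\<in>I. (g i)\<^sup>2) * card I)\<^sup>2"
    by (intro power_mono sum_squared_le_sum_of_squares) simp
  also have "\<dots> = (\<Sum>i\<in>I. (g i)\<^sup>2)\<^sup>2 * (real (card I))\<^sup>2" by (simp add: power_mult_distrib)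
  also have "\<dots> \<le> ((\<Sum>i\<in>I. ((g i)\<^sup>2)\<^sup>2) * card I) * (real (card I))\<^sup>2"
    by (intro mult_right_mono sum_squared_le_sum_of_squares) simp
  finally show ?thesis by (simp add: power2_eq_square power3_eq_cube numeral_eq_Suc mult_ac)
qed

lemma card_l_range_le:
  assumes "L \<ge> 1"
  shows "real (card (l_range L)) \<le> 3 * L"
proof -
  have "l_range L = {-\<lfloor>L\<rfloor>..\<lfloor>L\<rfloor>}" unfolding l_range_def by auto linarith+
  then have "real (card (l_range L)) \<le> 2 * L + 1" using assms by simp
  then show ?thesis using assms by linarith
qed

text \<open>Hoelder over \<open>l\<close> passes to fourth powers, which are then summed over three
  full periods modulo \<open>r\<close>. The constant is \<open>81 = 3 ^ 3 * 3\<close>: the cube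
  comes from the length of the range, the last 3 from the periods.\<close>

lemma l_range_moment_le:
  fixes a :: "'p \<Rightarrow> complex" and \<kappa> :: "'p \<Rightarrow> int"
  assumes fin: "finite P" and r: "r > 0" and a: "\<And>p. p \<in> P \<Longrightarrow> cmod (a p) \<le> B"
    and L: "1 \<le> L" "L \<le> real r"
  shows "(\<Sum>l\<in>l_range L. cmod (\<Sum>p\<in>P. a p * e_mod r (l * \<kappa> p))) ^ 4
    \<le> 81 * L ^ 3 * real r * B ^ 4 * real (card {((p, q), (p', q')). p \<in> P \<and> q \<in> P \<and> p' \<in> P \<and> q' \<in> P \<and>
         [\<kappa> p + \<kappa> q = \<kappa> p' + \<kappa> q'] (mod int r)})" (is "_ \<le> _ * real (card ?N)")
proof -
  let ?S = "\<lambda>l. cmod (\<Sum>p\<in>P. a p * e_mod r (l * \<kappa> p))"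
  have "(\<Sum>l\<in>l_range L. ?S l) ^ 4 \<le> real (card (l_range L)) ^ 3 * (\<Sum>l\<in>l_range L. ?S l ^ 4)"
    by (rule power4_sum_le)
  also have "\<dots> \<le> (3 * L) ^ 3 * (3 * (\<Sum>l<r. ?S (int l) ^ 4))"
    using card_l_range_le[OF L(1)] L r
    by (intro mult_mono power_mono sum_l_range_periodic_le sum_nonneg) (auto simp: e_mod_periodic)
  also have "\<dots> \<le> (3 * L) ^ 3 * (3 * (real r * B ^ 4 * real (card ?N)))"
    using fourth_moment_le[OF fin r a, where \<kappa> = \<kappa>] L by (intro mult_left_mono) auto
  also have "\<dots> = 81 * L ^ 3 * real r * B ^ 4 * real (card ?N)"
    by (simp only: power_mult_distrib mult.assoc) simp
  finally show ?thesis .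
qed

text \<open>The twist \<open>e_unit (l * \<theta> p)\<close> is removed by its Taylor expansion
  \<open>\<Sum>n. (2 * pi * \<i>) ^ n / fact n * (l / L) ^ n * (L * \<theta> p) ^ n\<close>, in which \<open>l\<close> and \<open>p\<close> are
  separated and both of the last two factors are at most 1 in size.\<close>
lemma sum_twisted_le:
  fixes c :: "'p \<Rightarrow> complex" and \<kappa> :: "'p \<Rightarrow> int" and \<theta> :: "'p \<Rightarrow> real"
  assumes fin: "finite P" and L: "L > 0" and c: "\<And>p. p \<in> P \<Longrightarrow> cmod (c p) \<le> B"
    and \<theta>: "\<And>p. p \<in> P \<Longrightarrow> \<bar>L * \<theta> p\<bar> \<le> 1"
    and Q: "\<And>a. (\<And>p. p \<in> P \<Longrightarrow> cmod (a p) \<le> B) \<Longrightarrow>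
      (\<Sum>l\<in>l_range L. cmod (\<Sum>p\<in>P. a p * e_mod r (l * \<kappa> p))) \<le> Q"
  shows "cmod (\<Sum>l\<in>l_range L. \<Sum>p\<in>P. c p * e_mod r (l * \<kappa> p) * e_unit (of_int l * \<theta> p)) \<le> exp (2 * pi) * Q"
proof -
  let ?u = "2 * complex_of_real pi * \<i>"
  define t where "t = (\<lambda>n l p. c p * e_mod r (l * \<kappa> p) * ((?u * complex_of_real (of_int l * \<theta> p)) ^ n /\<^sub>R fact n))"
  \<comment> \<open>The factor \<open>(L * \<theta> p) ^ n\<close> is absorbed into the coefficients
    without enlarging them beyond \<open>B\<close>, so the same \<open>Q\<close> serves for every
    Taylor term.\<close>
  define a where "a = (\<lambda>n p. c p * complex_of_real ((L * \<theta> p) ^ n))"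
  have "(\<lambda>n. \<Sum>l\<in>l_range L. \<Sum>p\<in>P. t n l p) sums
      (\<Sum>l\<in>l_range L. \<Sum>p\<in>P. c p * e_mod r (l * \<kappa> p) * e_unit (of_int l * \<theta> p))"
    unfolding t_def e_unit_def by (intro sums_sum sums_mult exp_converges)
  \<comment> \<open>The dominating series of the Taylor terms; its sum is the constant
    \<open>exp (2 * pi)\<close> in the claim.\<close>
  moreover have "(\<lambda>n. ((2 * pi) ^ n /\<^sub>R fact n) * Q) sums (exp (2 * pi) * Q)"
    by (intro sums_mult2 exp_converges)
  moreover have "cmod (\<Sum>l\<in>l_range L. \<Sum>p\<in>P. t n l p) \<le> ((2 * pi) ^ n /\<^sub>R fact n) * Q" for n
  proof -
    have "t n l p = (?u ^ n /\<^sub>R fact n) * (complex_of_real ((of_int l / L) ^ n) * (a n p * e_mod r (l * \<kappa> p)))" for l p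
      using L by (simp add: t_def a_def scaleR_conv_of_real power_mult_distrib power_divide field_simps)
    then have "(\<Sum>l\<in>l_range L. \<Sum>p\<in>P. t n l p) =
        (?u ^ n /\<^sub>R fact n) * (\<Sum>l\<in>l_range L. complex_of_real ((of_int l / L) ^ n) * (\<Sum>p\<in>P. a n p * e_mod r (l * \<kappa> p)))"
      by (simp only: sum_distrib_left)
    also have "cmod \<dots> \<le> cmod (?u ^ n /\<^sub>R fact n) * Q"
      unfolding norm_mult
    proof (rule mult_left_mono)
      have "cmod (\<Sum>l\<in>l_range L. complex_of_real ((of_int l / L) ^ n) * (\<Sum>p\<in>P. a n p * e_mod r (l * \<kappa> p)))
          \<le> (\<Sum>l\<in>l_range L. cmod (\<Sum>p\<in>P. a n p * e_mod r (l * \<kappa> p)))"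
      proof (rule sum_norm_le)
        fix l assume "l \<in> l_range L"
        then have "\<bar>of_int l / L\<bar> \<le> 1" using L by (simp add: l_range_def)
        then have "\<bar>of_int l / L\<bar> ^ n \<le> 1" by (intro power_le_one) auto
        then show "cmod (complex_of_real ((of_int l / L) ^ n) * (\<Sum>p\<in>P. a n p * e_mod r (l * \<kappa> p)))
            \<le> cmod (\<Sum>p\<in>P. a n p * e_mod r (l * \<kappa> p))"
          unfolding norm_mult norm_of_real power_abs by (intro mult_left_le_one_le) auto
      qed
      also have "\<dots> \<le> Q"
      proof (rule Q)
        fix p assume p: "p \<in> P"
        have "\<bar>L * \<theta> p\<bar> ^ n \<le> 1" using \<theta>[OF p] by (intro power_le_one) auto
        then have "cmod (c p) * \<bar>L * \<theta> p\<bar> ^ n \<le> cmod (c p)" by (intro mult_right_le_one_le) auto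
        then show "cmod (a n p) \<le> B"
          using c[OF p] unfolding a_def norm_mult norm_of_real power_abs by linarith
      qed
      finally show "cmod (\<Sum>l\<in>l_range L. complex_of_real ((of_int l / L) ^ n) * (\<Sum>p\<in>P. a n p * e_mod r (l * \<kappa> p))) \<le> Q" .
    qed simp
    also have "cmod (?u ^ n /\<^sub>R fact n) = (2 * pi) ^ n /\<^sub>R fact n"
      by (simp add: norm_mult norm_power)
    finally show ?thesis .
  qed
  ultimately show ?thesis by (rule norm_sums_le)
qed

subsection \<open>Decomposition into blocks\<close>

text \<open>Each element of \<open>P\<close> carries two consecutive entries of the eight-tuples, so
  four of them spell out one tuple counted by \<open>E4\<close>, and the congruence between the
  \<open>\<kappa>\<close> becomes the one between \<open>k 1, ..., k 8\<close>.\<close>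

lemma card_quadruples_le_E4:
  fixes P :: "((int \<times> int) \<times> (int \<times> int)) set"
  assumes P: "P \<subseteq> {((m, k), (m', k')). m \<in> m_range M \<and> k \<in> mod_sqrts r (int j * m) \<and>
      m' \<in> m_range M \<and> k' \<in> mod_sqrts r (int j * m') \<and> 1 \<le> \<bar>m - m'\<bar> \<and> \<bar>m - m'\<bar> \<le> int H}"
    and \<kappa>: "\<kappa> = (\<lambda>p. snd (fst p) - snd (snd p))"
  shows "card {((p, q), (p', q')). p \<in> P \<and> q \<in> P \<and> p' \<in> P \<and> q' \<in> P \<and>
         [\<kappa> p + \<kappa> q = \<kappa> p' + \<kappa> q'] (mod int r)} \<le> E4 r j M H" (is "card ?N \<le> _")
proof -
  \<comment> \<open>The tuple is read off a list, whose positions start at 0 while the tuples start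
    at 1; restriction to \<open>{1..8}\<close> makes it extensional.\<close>
  let ?v = "\<lambda>(g :: int \<times> int \<Rightarrow> int) ((p, q), (p', q')). \<lambda>i\<in>{1..8::nat}.
    [g (fst p), g (snd p), g (fst q), g (snd q), g (fst p'), g (snd p'), g (fst q'), g (snd q')] ! (i - 1)"
  let ?\<phi> = "\<lambda>x. (?v fst x, ?v snd x)"
  let ?E = "{(m, k). m \<in> {1..8::nat} \<rightarrow>\<^sub>E m_range M \<and>
     k \<in> (\<Pi>\<^sub>E i\<in>{1..8::nat}. mod_sqrts r (int j * m i)) \<and>
     (\<forall>i\<in>{1, 3, 5, 7}. 1 \<le> \<bar>m i - m (i + 1)\<bar> \<and> \<bar>m i - m (i + 1)\<bar> \<le> int H) \<and>
     [k 1 - k 2 + k 3 - k 4 = k 5 - k 6 + k 7 - k 8] (mod int r)}"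
  have set8: "{1..8::nat} = {1, 2, 3, 4, 5, 6, 7, 8}" by auto
  have ball8: "(\<forall>i\<in>{1..8}. R i) \<longleftrightarrow> R 1 \<and> R 2 \<and> R 3 \<and> R 4 \<and> R 5 \<and> R 6 \<and> R 7 \<and> R 8"
    for R :: "nat \<Rightarrow> bool"
    unfolding set8 by blast
  have "card ?N \<le> card ?E"
  proof (rule card_inj_on_le[of ?\<phi>])
    show "inj_on ?\<phi> ?N"
    proof (rule inj_onI)
      fix x y assume "?\<phi> x = ?\<phi> y"
      then have e: "?v fst x i = ?v fst y i" "?v snd x i = ?v snd y i" for i by auto
      obtain a1 a2 a3 a4 a5 a6 a7 a8 b1 b2 b3 b4 b5 b6 b7 b8 where x:
        "x = ((((a1, b1), (a2, b2)), ((a3, b3), (a4, b4))), (((a5, b5), (a6, b6)), ((a7, b7), (a8, b8))))"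
        by (metis surj_pair)
      obtain c1 c2 c3 c4 c5 c6 c7 c8 d1 d2 d3 d4 d5 d6 d7 d8 where y:
        "y = ((((c1, d1), (c2, d2)), ((c3, d3), (c4, d4))), (((c5, d5), (c6, d6)), ((c7, d7), (c8, d8))))"
        by (metis surj_pair)
      show "x = y"
        using e[of 1] e[of 2] e[of 3] e[of 4] e[of 5] e[of 6] e[of 7] e[of 8]
        unfolding x y by (simp add: nth_Cons')
    qed
    show "?\<phi> ` ?N \<subseteq> ?E"
    proof
      fix z assume "z \<in> ?\<phi> ` ?N"
      then obtain p q p' q' where z: "z = ?\<phi> ((p, q), (p', q'))"
        and in_P: "p \<in> P" "q \<in> P" "p' \<in> P" "q' \<in> P"
        and c: "[\<kappa> p + \<kappa> q = \<kappa> p' + \<kappa> q'] (mod int r)" by auto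
      obtain a1 a2 a3 a4 a5 a6 a7 a8 b1 b2 b3 b4 b5 b6 b7 b8 where pq:
        "p = ((a1, b1), (a2, b2))" "q = ((a3, b3), (a4, b4))"
        "p' = ((a5, b5), (a6, b6))" "q' = ((a7, b7), (a8, b8))"
        by (metis surj_pair)
      note * = in_P[THEN subsetD[OF P], unfolded pq mem_Collect_eq case_prod_conv]
      show "z \<in> ?E"
        unfolding z pq mem_Collect_eq case_prod_conv restrict_PiE_iff fst_conv snd_conv ball8
        using * c[unfolded pq \<kappa>] by (simp add: add_diff_eq)
    qed
    have "?E \<subseteq> ({1..8} \<rightarrow>\<^sub>E m_range M) \<times> ({1..8} \<rightarrow>\<^sub>E {0..<int r})"
      by (auto simp: PiE_def mod_sqrts_def Pi_def)
    then show "finite ?E"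
      by (rule finite_subset) (intro finite_cartesian_product finite_PiE; simp)
  qed
  then show ?thesis by (simp only: E4_def)
qed

text \<open>Each squared modulus expands over pairs inside one fibre of \<open>h\<close>. With
  \<open>h\<close> the number of a block, only pairs in a common block remain.\<close>

lemma sum_norm_square_fibres:
  fixes t :: "'x \<Rightarrow> complex"
  assumes fin: "finite X"
  shows "complex_of_real (\<Sum>b\<in>h ` X. (cmod (\<Sum>x | x \<in> X \<and> h x = b. t x))\<^sup>2) =
    (\<Sum>z | z \<in> X \<times> X \<and> h (fst z) = h (snd z). t (fst z) * cnj (t (snd z)))"
proof -
  let ?E = "{z. z \<in> X \<times> X \<and> h (fst z) = h (snd z)}"
  have finE: "finite ?E" by (rule finite_subset[of _ "X \<times> X"]) (use fin in auto)
  have im: "(\<lambda>z. h (fst z)) ` ?E = h ` X"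
  proof
    show "h ` X \<subseteq> (\<lambda>z. h (fst z)) ` ?E"
    proof
      fix b assume "b \<in> h ` X"
      then obtain x where "x \<in> X" "b = h x" by auto
      then show "b \<in> (\<lambda>z. h (fst z)) ` ?E" by (intro image_eqI[of _ _ "(x, x)"]) auto
    qed
  qed auto
  have "(\<Sum>z\<in>?E. t (fst z) * cnj (t (snd z))) =
      (\<Sum>b\<in>h ` X. \<Sum>z | z \<in> ?E \<and> h (fst z) = b. t (fst z) * cnj (t (snd z)))"
    using sum.image_gen[OF finE, of _ "\<lambda>z. h (fst z)"] unfolding im .
  also have "\<dots> = (\<Sum>b\<in>h ` X. complex_of_real ((cmod (\<Sum>x | x \<in> X \<and> h x = b. t x))\<^sup>2))"
  proof (rule sum.cong[OF refl])
    fix b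
    have eq: "{z. z \<in> ?E \<and> h (fst z) = b} = {x \<in> X. h x = b} \<times> {x \<in> X. h x = b}" by auto
    show "(\<Sum>z | z \<in> ?E \<and> h (fst z) = b. t (fst z) * cnj (t (snd z))) =
        complex_of_real ((cmod (\<Sum>x | x \<in> X \<and> h x = b. t x))\<^sup>2)"
      unfolding eq complex_norm_square
      by (simp add: sum_product sum.cartesian_product case_prod_beta)
  qed
  finally show ?thesis by simp
qed

lemma norm_le_norm_inf: "m \<in> m_range M \<Longrightarrow> cmod (\<beta> m) \<le> norm_inf M \<beta>"
  unfolding norm_inf_def by (intro Max_ge) auto

text \<open>The block numbers lie between 0 and \<open>M / H\<close>; the extra 1 in the count is
  absorbed because \<open>H \<le> M\<close>.\<close>

lemma card_blocks_le:
  fixes H :: nat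
  assumes "1 \<le> H" "real H \<le> M"
  shows "real (card ((\<lambda>m. m div int H) ` m_range M)) \<le> 2 * M / real H"
proof -
  have "(\<lambda>m. m div int H) ` m_range M \<subseteq> {0..\<lfloor>M / real H\<rfloor>}"
  proof safe
    fix m assume m: "m \<in> m_range M"
    have "real_of_int (m div int H) \<le> real_of_int m / real H"
      by (metis floor_divide_of_int_eq of_int_floor_le of_int_of_nat_eq)
    also have "\<dots> \<le> M / real H" using m by (auto simp: m_range_def divide_right_mono)
    finally show "m div int H \<in> {0..\<lfloor>M / real H\<rfloor>}"
      using m assms by (auto simp: m_range_def le_floor_iff pos_imp_zdiv_nonneg_iff)
  qed
  then have "card ((\<lambda>m. m div int H) ` m_range M) \<le> card {0..\<lfloor>M / real H\<rfloor>}"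
    by (intro card_mono) auto
  also have "real (card {0..\<lfloor>M / real H\<rfloor>}) \<le> M / real H + 1"
    using assms by simp
  also have "\<dots> \<le> 2 * M / real H" using assms by (simp add: field_simps)
  finally show ?thesis by simp
qed

lemma abs_diff_less_of_div_eq:
  fixes m m' :: int and H :: nat
  assumes "H > 0" "m div int H = m' div int H"
  shows "\<bar>m - m'\<bar> < int H"
proof -
  have "m - m' = m mod int H - m' mod int H"
    using div_mult_mod_eq[of m "int H"] div_mult_mod_eq[of m' "int H"] unfolding assms(2) by linarith
  moreover have "0 \<le> m mod int H" "m mod int H < int H" "0 \<le> m' mod int H" "m' mod int H < int H"
    using assms(1) by simp_all
  ultimately show ?thesis by linarith
qed

text \<open>The factor \<open>2 * M / H\<close> is the number of blocks, from Cauchy-Schwarz. In the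
  bracket, the first term comes from pairs with equal \<open>m\<close>, estimated trivially, and the
  second from pairs with distinct \<open>m\<close> in one block, where the twist is removed and the
  fourth moment is compared with \<open>E4\<close>.\<close>

lemma inner_sum_second_moment_le:
  fixes r j H :: nat and L M :: real and f :: "real \<Rightarrow> real" and \<beta> :: "int \<Rightarrow> complex"
  defines "X \<equiv> Sigma (m_range M) (\<lambda>m. mod_sqrts r (int j * m))"
  defines "t \<equiv> \<lambda>l x. \<beta> (fst x) * e_mod r (l * snd x) * e_unit (of_int l * f (of_int (fst x)))"
  assumes r: "r > 0" and L: "1 \<le> L" "L \<le> real r" and H: "1 \<le> H" "real H \<le> M"
    and f: "\<And>m m'. m \<in> m_range M \<Longrightarrow> m' \<in> m_range M \<Longrightarrow> \<bar>m - m'\<bar> \<le> int H \<Longrightarrow>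
      \<bar>L * (f (of_int m) - f (of_int m'))\<bar> \<le> 1"
  shows "(\<Sum>l\<in>l_range L. (cmod (\<Sum>x\<in>X. t l x))\<^sup>2) \<le> 2 * M / real H * (norm_inf M \<beta>)\<^sup>2 *
    (3 * L * (\<Sum>m\<in>m_range M. (real (card (mod_sqrts r (int j * m))))\<^sup>2) +
     exp (2 * pi) * root 4 (81 * L ^ 3 * real r * real (E4 r j M H)))"
proof -
  define h where "h = (\<lambda>x :: int \<times> int. fst x div int H)"
  define N where "N = norm_inf M \<beta>"
  define T where "T = (\<lambda>l z. t l (fst z) * cnj (t l (snd z)))"
  define E where "E = {z. z \<in> X \<times> X \<and> h (fst z) = h (snd z)}"
  \<comment> \<open>Only the \<open>m\<close>-components are required to differ: the complement
    \<open>E - D\<close> contains all pairs of roots of the same \<open>m\<close>, which is why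
    squares of root counts appear.\<close>
  define D where "D = {z\<in>E. fst (fst z) \<noteq> fst (snd z)}"
  have finX: "finite X" unfolding X_def by (intro finite_SigmaI) auto
  have finE: "finite E" unfolding E_def by (rule finite_subset[of _ "X \<times> X"]) (use finX in auto)
  then have finD: "finite D" by (simp add: D_def)
  have M: "M \<ge> 1" using H by simp
  have \<beta>N: "cmod (\<beta> (fst x)) \<le> N" if "x \<in> X" for x
    using norm_le_norm_inf that unfolding X_def N_def by auto
  \<comment> \<open>Nonemptiness of the range makes the maximum \<open>N\<close> dominate an actual
    modulus, hence nonnegative.\<close>
  have "1 \<in> m_range M" using M by (simp add: m_range_def)
  then have "N \<ge> 0" using norm_le_norm_inf[of 1 M \<beta>] unfolding N_def by (meson norm_ge_zero order_trans)
  have J: "real (card (h ` X)) \<le> 2 * M / real H"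
  proof -
    have "h ` X \<subseteq> (\<lambda>m. m div int H) ` m_range M" by (auto simp: h_def X_def)
    then have "real (card (h ` X)) \<le> real (card ((\<lambda>m. m div int H) ` m_range M))"
      by (simp add: card_mono)
    then show ?thesis using card_blocks_le[OF H] by linarith
  qed
  let ?V = "\<lambda>l. \<Sum>b\<in>h ` X. (cmod (\<Sum>x | x \<in> X \<and> h x = b. t l x))\<^sup>2"
  have "(\<Sum>l\<in>l_range L. (cmod (\<Sum>x\<in>X. t l x))\<^sup>2) \<le> (\<Sum>l\<in>l_range L. 2 * M / real H * ?V l)"
  proof (rule sum_mono)
    fix l
    have "(cmod (\<Sum>x\<in>X. t l x))\<^sup>2 \<le> (\<Sum>b\<in>h ` X. cmod (\<Sum>x | x \<in> X \<and> h x = b. t l x))\<^sup>2"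
      by (subst sum.image_gen[OF finX, of _ h]) (intro power_mono norm_sum, simp)
    also have "\<dots> \<le> ?V l * real (card (h ` X))"
      by (rule sum_squared_le_sum_of_squares)
    also have "\<dots> \<le> ?V l * (2 * M / real H)"
      by (intro mult_left_mono J sum_nonneg) simp
    finally show "(cmod (\<Sum>x\<in>X. t l x))\<^sup>2 \<le> 2 * M / real H * ?V l" by (simp only: mult.commute)
  qed
  also have "\<dots> = 2 * M / real H * (\<Sum>l\<in>l_range L. ?V l)"
    by (rule sum_distrib_left[symmetric])
  also have "\<dots> \<le> 2 * M / real H * (N\<^sup>2 *
    (3 * L * (\<Sum>m\<in>m_range M. (real (card (mod_sqrts r (int j * m))))\<^sup>2) +
     exp (2 * pi) * root 4 (81 * L ^ 3 * real r * real (E4 r j M H))))"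
  proof (rule mult_left_mono)
    have "complex_of_real (\<Sum>l\<in>l_range L. ?V l) = (\<Sum>l\<in>l_range L. \<Sum>z\<in>E. T l z)"
      unfolding of_real_sum[of _ "l_range L"] sum_norm_square_fibres[OF finX] E_def T_def ..
    also have "\<dots> = (\<Sum>l\<in>l_range L. (\<Sum>z\<in>E - D. T l z) + (\<Sum>z\<in>D. T l z))"
      by (intro sum.cong refl sum.subset_diff finE) (simp add: D_def)
    finally have eq: "complex_of_real (\<Sum>l\<in>l_range L. ?V l) =
      (\<Sum>l\<in>l_range L. \<Sum>z\<in>E - D. T l z) + (\<Sum>l\<in>l_range L. \<Sum>z\<in>D. T l z)"
      by (simp add: sum.distrib)
    have "(\<Sum>l\<in>l_range L. ?V l) = cmod (complex_of_real (\<Sum>l\<in>l_range L. ?V l))"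
      unfolding norm_of_real by (simp add: sum_nonneg)
    also have "\<dots> \<le> cmod (\<Sum>l\<in>l_range L. \<Sum>z\<in>E - D. T l z) + cmod (\<Sum>l\<in>l_range L. \<Sum>z\<in>D. T l z)"
      unfolding eq by (rule norm_triangle_ineq)
    also have "cmod (\<Sum>l\<in>l_range L. \<Sum>z\<in>E - D. T l z) \<le>
      3 * L * (N\<^sup>2 * (\<Sum>m\<in>m_range M. (real (card (mod_sqrts r (int j * m))))\<^sup>2))"
    proof -
      have T_le: "cmod (T l z) \<le> N\<^sup>2" if "z \<in> E" for l z
      proof -
        have "fst z \<in> X" "snd z \<in> X" using that by (auto simp: E_def)
        from this[THEN \<beta>N] show ?thesis using \<open>N \<ge> 0\<close>
          unfolding T_def t_def norm_mult power2_eq_square complex_mod_cnj by (simp add: mult_mono)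
      qed
      have "cmod (\<Sum>l\<in>l_range L. \<Sum>z\<in>E - D. T l z) \<le> (\<Sum>l\<in>l_range L. \<Sum>z\<in>E - D. N\<^sup>2)"
        by (intro sum_norm_le T_le) auto
      also have "\<dots> = real (card (l_range L)) * (N\<^sup>2 * real (card (E - D)))" by simp
      also have "\<dots> \<le> 3 * L * (N\<^sup>2 * (\<Sum>m\<in>m_range M. (real (card (mod_sqrts r (int j * m))))\<^sup>2))"
      proof (intro mult_mono card_l_range_le L mult_left_mono)
        let ?S = "Sigma (m_range M) (\<lambda>m. mod_sqrts r (int j * m) \<times> mod_sqrts r (int j * m))"
        have "E - D \<subseteq> (\<lambda>(m, k, k'). ((m, k), (m, k'))) ` ?S"
          by (force simp: E_def D_def X_def)
        moreover have finS: "finite ?S" by (intro finite_SigmaI finite_cartesian_product) auto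
        ultimately have "card (E - D) \<le> card ?S"
          by (meson card_image_le card_mono finite_imageI order_trans)
        then show "real (card (E - D)) \<le> (\<Sum>m\<in>m_range M. (real (card (mod_sqrts r (int j * m))))\<^sup>2)"
          by (simp add: card_cartesian_product power2_eq_square flip: of_nat_mult of_nat_sum)
      qed (use L in auto)
      finally show ?thesis .
    qed
    also have "cmod (\<Sum>l\<in>l_range L. \<Sum>z\<in>D. T l z) \<le>
      exp (2 * pi) * (N\<^sup>2 * root 4 (81 * L ^ 3 * real r * real (E4 r j M H)))"
    proof -
      define c where "c = (\<lambda>z :: (int \<times> int) \<times> (int \<times> int). \<beta> (fst (fst z)) * cnj (\<beta> (fst (snd z))))"
      define \<kappa> where "\<kappa> = (\<lambda>z :: (int \<times> int) \<times> (int \<times> int). snd (fst z) - snd (snd z))"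
      define \<theta> where "\<theta> = (\<lambda>z :: (int \<times> int) \<times> (int \<times> int). f (of_int (fst (fst z))) - f (of_int (fst (snd z))))"
      \<comment> \<open>Distinct \<open>m\<close> in one block differ by at least 1 and by less than
        \<open>H\<close>, which is the spacing condition in \<open>E4\<close>.\<close>
      have DX: "fst z \<in> X" "snd z \<in> X" "\<bar>fst (fst z) - fst (snd z)\<bar> \<le> int H"
          "fst (fst z) \<noteq> fst (snd z)" if "z \<in> D" for z
        using that abs_diff_less_of_div_eq[of H "fst (fst z)" "fst (snd z)"] H
        by (auto simp: D_def E_def h_def)
      have D_sub: "D \<subseteq> {((m, k), (m', k')). m \<in> m_range M \<and> k \<in> mod_sqrts r (int j * m) \<and>
        m' \<in> m_range M \<and> k' \<in> mod_sqrts r (int j * m') \<and> 1 \<le> \<bar>m - m'\<bar> \<and> \<bar>m - m'\<bar> \<le> int H}"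
      proof
        fix z assume "z \<in> D"
        obtain m k m' k' where z: "z = ((m, k), (m', k'))" by (metis surj_pair)
        show "z \<in> {((m, k), (m', k')). m \<in> m_range M \<and> k \<in> mod_sqrts r (int j * m) \<and>
          m' \<in> m_range M \<and> k' \<in> mod_sqrts r (int j * m') \<and> 1 \<le> \<bar>m - m'\<bar> \<and> \<bar>m - m'\<bar> \<le> int H}"
          using DX[OF \<open>z \<in> D\<close>] unfolding z X_def by auto
      qed
      have T_eq: "T l z = c z * e_mod r (l * \<kappa> z) * e_unit (of_int l * \<theta> z)" for l z
        unfolding T_def t_def c_def \<kappa>_def \<theta>_def right_diff_distrib e_mod_diff
        using e_unit_add[of "of_int l * f (of_int (fst (fst z)))" "- (of_int l * f (of_int (fst (snd z))))"]
        by (simp add: e_unit_minus mult_ac)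
      show ?thesis
        unfolding T_eq
      \<comment> \<open>The coefficients are products of two values of \<open>\<beta>\<close>, hence
        the bound \<open>N\<^sup>2\<close>.\<close>
      proof (rule sum_twisted_le[OF finD, where B = "N\<^sup>2"])
        fix z assume z: "z \<in> D"
        show "cmod (c z) \<le> N\<^sup>2"
          unfolding c_def norm_mult power2_eq_square complex_mod_cnj
          using \<beta>N[OF DX(1)[OF z]] \<beta>N[OF DX(2)[OF z]] \<open>N \<ge> 0\<close> by (intro mult_mono) auto
        show "\<bar>L * \<theta> z\<bar> \<le> 1"
          unfolding \<theta>_def using DX[OF z] by (intro f) (auto simp: X_def)
      next
        fix a assume a: "\<And>z. z \<in> D \<Longrightarrow> cmod (a z) \<le> N\<^sup>2"
        let ?Q = "\<Sum>l\<in>l_range L. cmod (\<Sum>z\<in>D. a z * e_mod r (l * \<kappa> z))"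
        have "?Q ^ 4 \<le> 81 * L ^ 3 * real r * (N\<^sup>2) ^ 4 * real (card {((p, q), (p', q')).
            p \<in> D \<and> q \<in> D \<and> p' \<in> D \<and> q' \<in> D \<and> [\<kappa> p + \<kappa> q = \<kappa> p' + \<kappa> q'] (mod int r)})"
          by (rule l_range_moment_le[OF finD r a L])
        also have "\<dots> \<le> 81 * L ^ 3 * real r * (N\<^sup>2) ^ 4 * real (E4 r j M H)"
          using card_quadruples_le_E4[OF D_sub \<kappa>_def] L by (intro mult_left_mono) auto
        also have "\<dots> = (N\<^sup>2 * root 4 (81 * L ^ 3 * real r * real (E4 r j M H))) ^ 4"
          using L by (simp add: power_mult_distrib)
        \<comment> \<open>Fourth roots are compared; the rule is stated for the exponent
          \<open>Suc n\<close>, so \<open>n = 3\<close>.\<close>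
        finally show "?Q \<le> N\<^sup>2 * root 4 (81 * L ^ 3 * real r * real (E4 r j M H))"
          by (rule power_le_imp_le_base[where n = 3, simplified]) (use L in simp)
      qed (use L in simp)
    qed
    finally show "(\<Sum>l\<in>l_range L. ?V l) \<le> N\<^sup>2 *
      (3 * L * (\<Sum>m\<in>m_range M. (real (card (mod_sqrts r (int j * m))))\<^sup>2) +
       exp (2 * pi) * root 4 (81 * L ^ 3 * real r * real (E4 r j M H)))"
      by (simp add: algebra_simps)
  qed (use M in simp)
  finally show ?thesis unfolding N_def by (simp add: mult.assoc)
qed

text \<open>Cauchy-Schwarz over \<open>l\<close>, after merging the sums over \<open>m\<close> and
  \<open>k\<close> into one sum over pairs.\<close>

lemma Sigma_sum_le_second_moment:
  "(cmod (Sigma_sum r j L M \<alpha> \<beta> f))\<^sup>2 \<le> (norm2 L \<alpha>)\<^sup>2 *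
    (\<Sum>l\<in>l_range L. (cmod (\<Sum>x\<in>Sigma (m_range M) (\<lambda>m. mod_sqrts r (int j * m)).
      \<beta> (fst x) * e_mod r (l * snd x) * e_unit (of_int l * f (of_int (fst x)))))\<^sup>2)"
proof -
  let ?t = "\<lambda>l. \<Sum>x\<in>Sigma (m_range M) (\<lambda>m. mod_sqrts r (int j * m)).
      \<beta> (fst x) * e_mod r (l * snd x) * e_unit (of_int l * f (of_int (fst x)))"
  have "(\<Sum>x\<in>Sigma (m_range M) (\<lambda>m. mod_sqrts r (int j * m)). g x) =
      (\<Sum>m\<in>m_range M. \<Sum>k\<in>mod_sqrts r (int j * m). g (m, k))" for g :: "int \<times> int \<Rightarrow> complex"
    by (subst sum.Sigma) (auto simp: case_prod_beta')
  then have "Sigma_sum r j L M \<alpha> \<beta> f = (\<Sum>l\<in>l_range L. \<alpha> l * ?t l)"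
    unfolding Sigma_sum_def by (simp add: sum_distrib_left mult.assoc)
  then have "(cmod (Sigma_sum r j L M \<alpha> \<beta> f))\<^sup>2 \<le> (\<Sum>l\<in>l_range L. cmod (\<alpha> l) * cmod (?t l))\<^sup>2"
    by (simp only:, intro power_mono sum_norm_le) (simp_all add: norm_mult)
  also have "\<dots> \<le> (\<Sum>l\<in>l_range L. (cmod (\<alpha> l))\<^sup>2) * (\<Sum>l\<in>l_range L. (cmod (?t l))\<^sup>2)"
    by (rule Cauchy_Schwarz_ineq_sum)
  finally show ?thesis by (simp add: norm2_def sum_nonneg)
qed

subsection \<open>The bilinear sum\<close>

text \<open>By the mean value inequality \<open>f\<close> varies by at most \<open>F * H\<close>
  between points of distance at most \<open>H\<close>, and \<open>L * F * H \<le> 1\<close>.\<close>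

lemma slow_variation:
  fixes f f' :: "real \<Rightarrow> real" and H :: nat
  assumes f': "\<forall>x\<in>{1..M}. (f has_real_derivative f' x) (at x within {1..M})"
    and F: "\<forall>x\<in>{1..M}. \<bar>f' x\<bar> \<le> F" and L: "1 \<le> L"
    and HF: "F = 0 \<or> real H \<le> 1 / (L * F)"
    and m: "m \<in> m_range M" "m' \<in> m_range M" "\<bar>m - m'\<bar> \<le> int H"
  shows "\<bar>L * (f (of_int m) - f (of_int m'))\<bar> \<le> 1"
proof -
  have mem: "of_int m \<in> {1..M}" "of_int m' \<in> {1..M}" using m by (auto simp: m_range_def)
  then have "F \<ge> 0" using F by (meson abs_ge_zero order_trans)
  have "\<bar>f (of_int m) - f (of_int m')\<bar> \<le> F * \<bar>of_int m - of_int m'\<bar>"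
    using field_differentiable_bound[OF convex_real_interval(5)[of 1 M], of f f' F "of_int m" "of_int m'"]
      f' F mem by auto
  also have "\<dots> \<le> F * real H"
    using m(3) \<open>F \<ge> 0\<close> by (intro mult_left_mono) linarith+
  finally have "L * \<bar>f (of_int m) - f (of_int m')\<bar> \<le> L * (F * real H)"
    using L by (intro mult_left_mono) auto
  also have "\<dots> \<le> 1"
  \<comment> \<open>For \<open>F = 0\<close>, where \<open>1 / (L * F)\<close> stands for infinity,
    the left-hand side vanishes.\<close>
  proof (cases "F = 0")
    case False
    then have "L * F > 0" using \<open>F \<ge> 0\<close> L by simp
    then show ?thesis using HF False by (simp add: field_simps)
  qed simp
  finally show ?thesis using L by (simp add: abs_mult)
qed

section \<open>Comparison with the terms of the final bound\<close>

text \<open>The mixed terms are nonnegative. This gathers two eighth powers into a single one, whose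
  fourth root is an exact square.\<close>

lemma add_power_le_power_add:
  fixes x y :: real
  assumes "0 \<le> x" "0 \<le> y" "n > 0"
  shows "x ^ n + y ^ n \<le> (x + y) ^ n"
  using assms(3)
proof (induction n rule: nat_induct_non_zero)
  case (Suc n)
  have "x ^ Suc n + y ^ Suc n \<le> (x + y) * (x ^ n + y ^ n)"
    using assms by (simp add: algebra_simps)
  also have "\<dots> \<le> (x + y) * (x + y) ^ n"
    using Suc.IH assms by (intro mult_left_mono) auto
  finally show ?case by simp
qed simp

text \<open>Both sides are compared through their fourth powers. The right-hand side is already a
  square, so eighth powers of the two terms arise; these have no fractional exponents apart from
  \<open>\<nu>\<close> and match the two terms of the bound for \<open>E\<close>.\<close>

lemma off_diagonal_factor_le:
  fixes H r :: nat and \<nu> L M C E \<epsilon> :: real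
  assumes pos: "1 \<le> H" "0 < r" "1 \<le> L" "1 \<le> M" "0 \<le> C"
    and E: "E \<le> C * real H powr (2 - \<nu>) * M\<^sup>2 * (real H ^ 3 * M\<^sup>2 / real r + real H * M) * real r powr (8 * \<epsilon>)"
  shows "2 * M / real H * root 4 (81 * L ^ 3 * real r * E) \<le> 6 * root 4 C *
    (real H powr (1/8 - \<nu>/8) * L powr (3/8) * M
      + real H powr (-1/8 - \<nu>/8) * L powr (3/8) * M powr (7/8) * real r powr (1/8))\<^sup>2 * (real r powr \<epsilon>)\<^sup>2"
    (is "_ \<le> 6 * root 4 C * (?A + ?B)\<^sup>2 * (real r powr \<epsilon>)\<^sup>2")
proof -
  define h \<rho> where "h = real H" and "\<rho> = real r"
  have p: "h > 0" "\<rho> > 0" "L > 0" "M > 0" using pos by (auto simp: h_def \<rho>_def)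
  have A8: "?A ^ 8 = h powr (1 - \<nu>) * L ^ 3 * M ^ 8"
    using p by (simp add: power_mult_distrib powr_power h_def[symmetric] algebra_simps)
  have B8: "?B ^ 8 = h powr (- 1 - \<nu>) * L ^ 3 * M ^ 7 * \<rho>"
    using p by (simp add: power_mult_distrib powr_power h_def[symmetric] \<rho>_def[symmetric] algebra_simps)
  have h1: "h powr (2 - \<nu>) * h ^ 3 / h ^ 4 = h powr (1 - \<nu>)"
    using p by (simp add: powr_diff field_simps power2_eq_square numeral_eq_Suc)
  have h2: "h powr (2 - \<nu>) * h / h ^ 4 = h powr (- 1 - \<nu>)"
    using p by (simp add: powr_diff powr_minus field_simps power2_eq_square numeral_eq_Suc)
  have "(2 * M / h) ^ 4 * (81 * L ^ 3 * \<rho> * E) \<le> (2 * M / h) ^ 4 * (81 * L ^ 3 * \<rho> *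
      (C * h powr (2 - \<nu>) * M\<^sup>2 * (h ^ 3 * M\<^sup>2 / \<rho> + h * M) * \<rho> powr (8 * \<epsilon>)))"
    using E p unfolding h_def \<rho>_def by (intro mult_left_mono) auto
  \<comment> \<open>\<open>1296 = 2 ^ 4 * 81 = 6 ^ 4\<close>, the source of the factor 6.\<close>
  also have "\<dots> = 1296 * C * ((h powr (2 - \<nu>) * h ^ 3 / h ^ 4) * L ^ 3 * M ^ 8 +
      (h powr (2 - \<nu>) * h / h ^ 4) * L ^ 3 * M ^ 7 * \<rho>) * \<rho> powr (8 * \<epsilon>)"
    using p by (simp add: field_simps) (simp add: eval_nat_numeral)
  also have "\<dots> = 1296 * C * (?A ^ 8 + ?B ^ 8) * (\<rho> powr \<epsilon>) ^ 8"
    unfolding h1 h2 A8 B8 using p by (simp add: powr_power mult.commute)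
  also have "\<dots> \<le> 1296 * C * (?A + ?B) ^ 8 * (\<rho> powr \<epsilon>) ^ 8"
  proof (intro mult_right_mono mult_left_mono)
    show "?A ^ 8 + ?B ^ 8 \<le> (?A + ?B) ^ 8"
      using p by (intro add_power_le_power_add) auto
  qed (use pos in auto)
  finally have "root 4 ((2 * M / h) ^ 4 * (81 * L ^ 3 * \<rho> * E)) \<le>
      root 4 (6 ^ 4 * C * (?A + ?B) ^ 8 * (\<rho> powr \<epsilon>) ^ 8)" by simp
  moreover have root_8: "root 4 (x ^ 8) = x\<^sup>2" if "x \<ge> 0" for x :: real
    using real_root_power_cancel[of 4 "x\<^sup>2"] that by (simp flip: power_mult)
  have "root 4 (6 ^ 4 * C * (?A + ?B) ^ 8 * (\<rho> powr \<epsilon>) ^ 8) = 6 * root 4 C * (?A + ?B)\<^sup>2 * (\<rho> powr \<epsilon>)\<^sup>2"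
    using p by (simp add: real_root_mult root_8)
  moreover have "root 4 ((2 * M / h) ^ 4 * (81 * L ^ 3 * \<rho> * E)) = 2 * M / h * root 4 (81 * L ^ 3 * \<rho> * E)"
    using p unfolding real_root_mult[of _ "(2 * M / h) ^ 4"] by (subst real_root_power_cancel) auto
  ultimately show ?thesis unfolding h_def \<rho>_def by simp
qed

theorem theorem1p7:
  fixes \<nu> :: real and C :: "real \<Rightarrow> real"
  assumes "\<nu> > 0"
    and "\<And>\<epsilon> r j M H. \<epsilon> > 0 \<Longrightarrow> r > 0 \<Longrightarrow> j > 0 \<Longrightarrow> coprime r j \<Longrightarrow>
           1 \<le> real H \<Longrightarrow> real H \<le> M \<Longrightarrow> M \<le> real r \<Longrightarrow>
           real (E4 r j M H) \<le>
             C \<epsilon> * real H powr (2 - \<nu>) * M\<^sup>2 *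
             (real H ^ 3 * M\<^sup>2 / real r + real H * M) * real r powr \<epsilon>"
  shows "\<forall>\<epsilon>>0. \<exists>K. \<forall>(r::nat) (j::nat) (L::real) (M::real) (F::real) (H::nat)
           (f :: real \<Rightarrow> real) (f' :: real \<Rightarrow> real) (\<alpha> :: int \<Rightarrow> complex) (\<beta> :: int \<Rightarrow> complex).
           r > 0 \<longrightarrow> j > 0 \<longrightarrow> coprime r j \<longrightarrow>
           1 \<le> L \<longrightarrow> L \<le> real r \<longrightarrow> 1 \<le> M \<longrightarrow> M \<le> real r \<longrightarrow>
           (\<forall>x\<in>{1..M}. (f has_real_derivative f' x) (at x within {1..M})) \<longrightarrow>
           continuous_on {1..M} f' \<longrightarrow>
           (\<forall>x\<in>{1..M}. \<bar>f' x\<bar> \<le> F) \<longrightarrow> F \<le> 1 / L \<longrightarrow>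
           1 \<le> H \<longrightarrow> (F = 0 \<or> real H \<le> 1 / (L * F)) \<longrightarrow> real H \<le> M \<longrightarrow>
           cmod (Sigma_sum r j L M \<alpha> \<beta> f) \<le>
             K * (real H powr (-1/2) * L powr (1/2) * M
                + real H powr (1/8 - \<nu>/8) * L powr (3/8) * M
                + real H powr (-1/8 - \<nu>/8) * L powr (3/8) * M powr (7/8) * real r powr (1/8))
               * norm2 L \<alpha> * norm_inf M \<beta> * real r powr \<epsilon>"
proof (intro allI impI)
  fix \<epsilon> :: real assume \<epsilon>: "\<epsilon> > 0"
  then obtain D where D: "D > 0" "\<And>n. n > 0 \<Longrightarrow> real (card {d. d dvd n}) \<le> D * real n powr \<epsilon>"
    using divisor_bound by blast
  \<comment> \<open>No sign is assumed for \<open>C\<close>, so it is truncated at 0. The exponent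
    \<open>8 * \<epsilon>\<close> becomes \<open>\<epsilon>\<close> after the fourth root here and
    the final square root.\<close>
  define C' where "C' = max 0 (C (8 * \<epsilon>))"
  \<comment> \<open>The square of \<open>K\<close> adds the diagonal constant
    \<open>24 * D\<^sup>2\<close>, where \<open>24 = 2 * 3 * 4\<close>, to the off-diagonal
    one.\<close>
  define K where "K = sqrt (24 * D\<^sup>2 + 6 * exp (2 * pi) * root 4 C')"
  have C': "C' \<ge> 0" by (simp add: C'_def)
  show "\<exists>K. \<forall>(r::nat) (j::nat) (L::real) (M::real) (F::real) (H::nat)
           (f :: real \<Rightarrow> real) (f' :: real \<Rightarrow> real) (\<alpha> :: int \<Rightarrow> complex) (\<beta> :: int \<Rightarrow> complex).
           r > 0 \<longrightarrow> j > 0 \<longrightarrow> coprime r j \<longrightarrow>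
           1 \<le> L \<longrightarrow> L \<le> real r \<longrightarrow> 1 \<le> M \<longrightarrow> M \<le> real r \<longrightarrow>
           (\<forall>x\<in>{1..M}. (f has_real_derivative f' x) (at x within {1..M})) \<longrightarrow>
           continuous_on {1..M} f' \<longrightarrow>
           (\<forall>x\<in>{1..M}. \<bar>f' x\<bar> \<le> F) \<longrightarrow> F \<le> 1 / L \<longrightarrow>
           1 \<le> H \<longrightarrow> (F = 0 \<or> real H \<le> 1 / (L * F)) \<longrightarrow> real H \<le> M \<longrightarrow>
           cmod (Sigma_sum r j L M \<alpha> \<beta> f) \<le>
             K * (real H powr (-1/2) * L powr (1/2) * M
                + real H powr (1/8 - \<nu>/8) * L powr (3/8) * M
                + real H powr (-1/8 - \<nu>/8) * L powr (3/8) * M powr (7/8) * real r powr (1/8))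
               * norm2 L \<alpha> * norm_inf M \<beta> * real r powr \<epsilon>"
  proof (intro exI[of _ K] allI impI)
    fix r j H :: nat and L M F :: real and f f' :: "real \<Rightarrow> real" and \<alpha> \<beta> :: "int \<Rightarrow> complex"
    assume r: "r > 0" and j: "j > 0" and cop: "coprime r j" and L: "1 \<le> L" "L \<le> real r"
      and M: "1 \<le> M" "M \<le> real r"
      and f': "\<forall>x\<in>{1..M}. (f has_real_derivative f' x) (at x within {1..M})"
      and F: "\<forall>x\<in>{1..M}. \<bar>f' x\<bar> \<le> F"
      and H: "1 \<le> H" and HF: "F = 0 \<or> real H \<le> 1 / (L * F)" and HM: "real H \<le> M"
    let ?A1 = "real H powr (-1/2) * L powr (1/2) * M"
    let ?A2 = "real H powr (1/8 - \<nu>/8) * L powr (3/8) * M"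
    let ?A3 = "real H powr (-1/8 - \<nu>/8) * L powr (3/8) * M powr (7/8) * real r powr (1/8)"
    let ?N = "norm_inf M \<beta>" and ?G = "(real r powr \<epsilon>)\<^sup>2"
    let ?R = "\<Sum>m\<in>m_range M. (real (card (mod_sqrts r (int j * m))))\<^sup>2"
    let ?E = "real (E4 r j M H)"
    have pos: "real H > 0" "L > 0" "M > 0" using H L M by auto
    have nonneg: "?A1 \<ge> 0" "?A2 \<ge> 0" "?A3 \<ge> 0" using pos by auto
    have "1 \<in> m_range M" using M by (simp add: m_range_def)
    then have N: "?N \<ge> 0" using norm_le_norm_inf[of 1 M \<beta>] by (meson norm_ge_zero order_trans)
    have diag: "2 * M / real H * (3 * L * ?R) \<le> 24 * D\<^sup>2 * ?A1\<^sup>2 * ?G"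
    proof -
      have "?R \<le> 4 * M * (real (card {d. d dvd r}))\<^sup>2"
        using sum_card_mod_sqrts_le[OF r cop, of M] M by simp
      also have "\<dots> \<le> 4 * M * (D * real r powr \<epsilon>)\<^sup>2"
        using D(2)[OF r] pos by (intro mult_left_mono power_mono) auto
      finally have "2 * M / real H * (3 * L * ?R) \<le> 2 * M / real H * (3 * L * (4 * M * (D * real r powr \<epsilon>)\<^sup>2))"
        using pos by (intro mult_left_mono) auto
      also have "\<dots> = 24 * D\<^sup>2 * (L * M\<^sup>2 / real H) * ?G"
        by (simp add: power2_eq_square)
      also have "L * M\<^sup>2 / real H = ?A1\<^sup>2"
        using pos by (simp add: power_mult_distrib power_divide powr_minus_divide powr_half_sqrt)
      finally show ?thesis .
    qed
    have "?E \<le> C (8 * \<epsilon>) * real H powr (2 - \<nu>) * M\<^sup>2 *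
        (real H ^ 3 * M\<^sup>2 / real r + real H * M) * real r powr (8 * \<epsilon>)"
      using assms(2)[of "8 * \<epsilon>" r j H M] \<epsilon> r j cop H HM M by simp
    also have "\<dots> \<le> C' * real H powr (2 - \<nu>) * M\<^sup>2 *
        (real H ^ 3 * M\<^sup>2 / real r + real H * M) * real r powr (8 * \<epsilon>)"
      using pos by (intro mult_right_mono) (auto simp: C'_def)
    finally have off: "2 * M / real H * root 4 (81 * L ^ 3 * real r * ?E) \<le> 6 * root 4 C' * (?A2 + ?A3)\<^sup>2 * ?G"
      by (intro off_diagonal_factor_le H r L M C')
    have "(cmod (Sigma_sum r j L M \<alpha> \<beta> f))\<^sup>2 \<le> (norm2 L \<alpha>)\<^sup>2 *
        (2 * M / real H * ?N\<^sup>2 * (3 * L * ?R + exp (2 * pi) * root 4 (81 * L ^ 3 * real r * ?E)))"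
      by (rule order_trans[OF Sigma_sum_le_second_moment])
         (intro mult_left_mono inner_sum_second_moment_le r L H HM slow_variation[OF f' F L(1) HF], simp_all)
    also have "\<dots> = (norm2 L \<alpha>)\<^sup>2 * (?N\<^sup>2 * (2 * M / real H * (3 * L * ?R) +
        exp (2 * pi) * (2 * M / real H * root 4 (81 * L ^ 3 * real r * ?E))))"
      by (simp add: distrib_left mult_ac)
    also have "\<dots> \<le> (norm2 L \<alpha>)\<^sup>2 * (?N\<^sup>2 * (24 * D\<^sup>2 * ?A1\<^sup>2 * ?G +
        exp (2 * pi) * (6 * root 4 C' * (?A2 + ?A3)\<^sup>2 * ?G)))"
      by (intro mult_left_mono add_mono diag off) auto
    \<comment> \<open>Enlarging each part to the full sum of three terms produces a common square,
      so that the whole bound is a perfect square.\<close>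
    also have "\<dots> \<le> (norm2 L \<alpha>)\<^sup>2 * (?N\<^sup>2 * (24 * D\<^sup>2 * (?A1 + ?A2 + ?A3)\<^sup>2 * ?G +
        exp (2 * pi) * (6 * root 4 C' * (?A1 + ?A2 + ?A3)\<^sup>2 * ?G)))"
      using nonneg C' by (intro mult_left_mono mult_right_mono add_mono power_mono) auto
    also have "\<dots> = K\<^sup>2 * (?A1 + ?A2 + ?A3)\<^sup>2 * (norm2 L \<alpha>)\<^sup>2 * ?N\<^sup>2 * ?G"
    proof -
      have "K\<^sup>2 = 24 * D\<^sup>2 + 6 * exp (2 * pi) * root 4 C'"
        unfolding K_def using C' by simp
      then show ?thesis by (simp only: distrib_left distrib_right mult_ac)
    qed
    also have "\<dots> = (K * (?A1 + ?A2 + ?A3) * norm2 L \<alpha> * ?N * real r powr \<epsilon>)\<^sup>2"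
      by (simp only: power_mult_distrib)
    finally show "cmod (Sigma_sum r j L M \<alpha> \<beta> f) \<le> K * (?A1 + ?A2 + ?A3) * norm2 L \<alpha> * ?N * real r powr \<epsilon>"
      by (rule power2_le_imp_le)
         (use nonneg N C' in \<open>auto simp: K_def norm2_def intro!: mult_nonneg_nonneg sum_nonneg\<close>)
  qed
qed

end
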